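(* Let $A\in GL_n(\mathbb{R})$ be expanding on a subspace. Then the family $\{A^j\}_{j\in\mathbb{Z}}$ of automorphisms of $\mathbb{R}^n$ is expanding (with respect to the Euclidean metric); that is, there exist functions $\ell,L:\mathbb{Z}\to(0,\infty)$ with $$\ell(j)|x|\le|A^jx|\le L(j)|x|\qquad\forall\,x\in\mathbb{R}^n,\ \forall\,j\in\mathbb{Z},$$ and constants $M_0,N_0>0$ such that, for all $M>M_0$ and all $j\in\mathbb{Z}$, $L(j)>M$ implies $\ell(j)>N_0$.
   Context: $|\cdot|$ is the Euclidean norm. A matrix $A\in GL_n(\mathbb{R})$ is expanding on a subspace if there is a non-zero linear subspace $F\subset\mathbb{R}^n$ and a linear subspace $E\subset\mathbb{R}^n$ such that: (i) $\mathbb{R}^n=F+E$ and $F\cap E=\{0\}$; (ii) $A(F)=F$ and $A(E)=E$; (iii) there exist $0<k\le1<\gamma<\infty$ such that $|A^jx|\ge k\gamma^j|x|$ for all integers $j\ge0$ and all $x\in F$; (iv) there exists $a>0$ such that $|A^jx|\ge a|x|$ for all integers $j\ge0$ and all $x\in E$. *)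

theory Defs
  imports "HOL-Analysis.Analysis"
begin

(* Multiplication on the type real ^ 'n ^ 'n is componentwise, so the library power A ^ j is not
   the matrix power; powers with respect to ** are defined here. *)

primrec matrix_pow :: "real ^ 'n ^ 'n \<Rightarrow> nat \<Rightarrow> real ^ 'n ^ 'n" where
  "matrix_pow A 0 = mat 1"
| "matrix_pow A (Suc j) = A ** matrix_pow A j"

definition matrix_powi :: "real ^ 'n ^ 'n \<Rightarrow> int \<Rightarrow> real ^ 'n ^ 'n" where
  "matrix_powi A j =
    (if j \<ge> 0 then matrix_pow A (nat j) else matrix_pow (matrix_inv A) (nat (- j)))"

definition expanding_on_subspace :: "real ^ 'n ^ 'n \<Rightarrow> bool" where
  "expanding_on_subspace A \<longleftrightarrow>
    (\<exists>F E. subspace F \<and> F \<noteq> {0} \<and> subspace E \<and>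
      {u + v | u v. u \<in> F \<and> v \<in> E} = UNIV \<and> F \<inter> E = {0} \<and>
      (*v) A ` F = F \<and> (*v) A ` E = E \<and>
      (\<exists>k \<gamma>. 0 < k \<and> k \<le> 1 \<and> 1 < \<gamma> \<and>
        (\<forall>j::nat. \<forall>x\<in>F. norm (matrix_pow A j *v x) \<ge> k * \<gamma> ^ j * norm x)) \<and>
      (\<exists>a>0. \<forall>j::nat. \<forall>x\<in>E. norm (matrix_pow A j *v x) \<ge> a * norm x))"

definition expanding_family :: "('j \<Rightarrow> real ^ 'n ^ 'n) \<Rightarrow> bool" where
  "expanding_family T \<longleftrightarrow>
    (\<forall>j. invertible (T j)) \<and>
    (\<exists>l L :: 'j \<Rightarrow> real.
      (\<forall>j. 0 < l j) \<and> (\<forall>j. 0 < L j) \<and>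
      (\<forall>x j. l j * norm x \<le> norm (T j *v x) \<and> norm (T j *v x) \<le> L j * norm x) \<and>
      (\<exists>M\<^sub>0>0. \<exists>N\<^sub>0>0. \<forall>M>M\<^sub>0. \<forall>j. L j > M \<longrightarrow> l j > N\<^sub>0))"

end

(* On F + E the projections onto the two summands are bounded, so the lower bounds on F and on E
   combine to a bound |A^j x| >= c |x| with c > 0 independent of j >= 0.  Hence |A^j x| <= |x| / c
   for j < 0: upper constants above 1/c can occur only for j >= 0, where the lower constant is c. *)
theory Submission
  imports Defs
begin

lemma matrix_pow_Suc_right: "matrix_pow A (Suc j) = matrix_pow A j ** A"
  by (induction j) (simp_all add: matrix_mul_assoc)

lemma matrix_pow_right_inverse:
  assumes "A ** B = mat 1"
  shows "matrix_pow A j ** matrix_pow B j = mat 1"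
proof (induction j)
  case (Suc j)
  \<comment> \<open>Splitting \<open>A\<close> off on the right and \<open>B\<close> on the left
    makes the two meet in the middle, where they cancel without any commutation.\<close>
  have "matrix_pow A (Suc j) ** matrix_pow B (Suc j) = matrix_pow A j ** (A ** B) ** matrix_pow B j"
    unfolding matrix_pow_Suc_right[of A] by (simp add: matrix_mul_assoc)
  then show ?case
    using Suc assms by simp
qed simp

lemma matrix_inv_inverse:
  assumes "invertible A"
  shows "A ** matrix_inv A = mat 1" "matrix_inv A ** A = mat 1"
  using someI_ex[OF assms[unfolded invertible_def]] by (simp_all add: matrix_inv_def)

lemma matrix_pow_mem:
  assumes "(*v) A ` S \<subseteq> S" "x \<in> S"
  shows "matrix_pow A j *v x \<in> S"
  using assms by (induction j) (auto simp flip: matrix_vector_mul_assoc)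

lemma matrix_vector_mul_upper_bound:
  fixes T :: "real ^ 'n ^ 'm"
  obtains C where "C > 0" "\<And>x. norm (T *v x) \<le> C * norm x"
  using bounded_linear.pos_bounded[OF matrix_vector_mul_bounded_linear[of T]]
  by (metis mult.commute)

text \<open>Addition is linear on \<open>F \<times> E\<close> and injective there because
  \<open>F\<close> and \<open>E\<close> meet only in 0. In finite dimension such a map is bounded
  below; equivalently, both projections from the sum have norm at most \<open>1 / e\<close>.\<close>

lemma complementary_subspaces_norm_bound:
  fixes F E :: "'a::euclidean_space set"
  assumes F: "subspace F" and E: "subspace E" and FE: "F \<inter> E = {0}"
  obtains e where "e > 0"
    "\<And>u v. u \<in> F \<Longrightarrow> v \<in> E \<Longrightarrow> e * norm u \<le> norm (u + v) \<and> e * norm v \<le> norm (u + v)"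
proof -
  have sub: "subspace (F \<times> E)"
    using F E by (rule subspace_Times)
  have inj: "p = 0" if "p \<in> F \<times> E" "fst p + snd p = 0" for p
  proof -
    have "fst p = - snd p"
      using that by (simp add: eq_neg_iff_add_eq_0)
    with that E subspace_neg[of E "snd p"] have "fst p \<in> F \<inter> E"
      by (auto simp: mem_Times_iff)
    with FE \<open>fst p = - snd p\<close> show ?thesis
      by (simp add: prod_eq_iff)
  qed
  have bl: "bounded_linear (\<lambda>p::'a \<times> 'a. fst p + snd p)"
    by (intro bounded_linear_add bounded_linear_fst bounded_linear_snd)
  obtain e where e: "e > 0" "\<And>p. p \<in> F \<times> E \<Longrightarrow> e * norm p \<le> norm (fst p + snd p)"
    using injective_imp_isometric[OF closed_subspace[OF sub] sub bl] inj by auto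
  have "e * norm u \<le> norm (u + v) \<and> e * norm v \<le> norm (u + v)" if "u \<in> F" "v \<in> E" for u v
  proof -
    have "e * norm (u, v) \<le> norm (u + v)"
      using e(2)[of "(u, v)"] that by simp
    moreover have "e * norm u \<le> e * norm (u, v)" "e * norm v \<le> e * norm (u, v)"
      using e(1) norm_fst_le[of u v] norm_snd_le[of v u] by simp_all
    ultimately show ?thesis
      by linarith
  qed
  with e(1) show thesis
    by (rule that)
qed

text \<open>The point is that \<open>c\<close> does not depend on \<open>j\<close>. By invariance,
  the components of the image of \<open>x\<close> are the images of the components of
  \<open>x\<close>, so one projection bound serves all powers.\<close>

lemma expanding_on_subspace_lower_bound:
  assumes "expanding_on_subspace A"
  obtains c where "c > 0" "\<And>j x. c * norm x \<le> norm (matrix_pow A j *v x)"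
proof -
  obtain F E k \<gamma> a where sum: "{u + v | u v. u \<in> F \<and> v \<in> E} = UNIV"
    and F: "subspace F" and E: "subspace E" and FE: "F \<inter> E = {0}"
    and AF: "(*v) A ` F = F" and AE: "(*v) A ` E = E"
    and k: "0 < k" "1 < \<gamma>" "\<forall>j. \<forall>x\<in>F. norm (matrix_pow A j *v x) \<ge> k * \<gamma> ^ j * norm x"
    and a: "0 < a" "\<forall>j. \<forall>x\<in>E. norm (matrix_pow A j *v x) \<ge> a * norm x"
    using assms unfolding expanding_on_subspace_def by (elim exE conjE) (rule that)
  obtain e where e: "e > 0"
    "\<And>u v. u \<in> F \<Longrightarrow> v \<in> E \<Longrightarrow> e * norm u \<le> norm (u + v) \<and> e * norm v \<le> norm (u + v)"
    using complementary_subspaces_norm_bound[OF F E FE] by blast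
  define m where "m = min k a"
  have m: "m > 0" "m \<le> k" "m \<le> a"
    using k(1) a(1) by (auto simp: m_def)
  \<comment> \<open>Here \<open>m\<close> bounds the powers below on both summands, \<open>e\<close>
    comes from the projections, and the 2 from adding two component estimates.\<close>
  have "e * m / 2 * norm x \<le> norm (matrix_pow A j *v x)" for j x
  proof -
    obtain u v where uv: "u \<in> F" "v \<in> E" "x = u + v"
      using sum by blast
    let ?u = "matrix_pow A j *v u" and ?v = "matrix_pow A j *v v"
    have mem: "?u \<in> F" "?v \<in> E"
      using AF AE uv by (auto intro: matrix_pow_mem)
    have "m \<le> k * \<gamma> ^ j"
      using m(2) k(1,2) mult_left_mono[of 1 "\<gamma> ^ j" k] one_le_power[of \<gamma> j] by linarith
    then have "m * norm u \<le> norm ?u"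
      using k(3)[rule_format, OF uv(1), of j] mult_right_mono[of m "k * \<gamma> ^ j" "norm u"]
      by simp
    moreover have "m * norm v \<le> norm ?v"
      using a(2)[rule_format, OF uv(2), of j] m(3) mult_right_mono[of m a "norm v"] by simp
    moreover have "m * norm x \<le> m * norm u + m * norm v"
      using m(1) norm_triangle_ineq[of u v] uv(3) by (simp flip: distrib_left)
    ultimately have "m * norm x \<le> norm ?u + norm ?v"
      by linarith
    then have "e * (m * norm x) \<le> e * norm ?u + e * norm ?v"
      using e(1) by (simp flip: distrib_left)
    \<comment> \<open>The projection bound is applied to the image \<open>?u + ?v\<close>, not to
      \<open>x\<close>.\<close>
    also have "\<dots> \<le> 2 * norm (?u + ?v)"
      using e(2)[OF mem] by linarith
    finally show ?thesis
      using uv(3) by (simp add: matrix_vector_right_distrib)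
  qed
  moreover have "e * m / 2 > 0"
    using e(1) m(1) by simp
  ultimately show thesis
    using that by blast
qed

theorem proposition32:
  fixes A :: "real ^ 'n ^ 'n"
  assumes "invertible A"
    and "expanding_on_subspace A"
  shows "expanding_family (matrix_powi A)"
proof -
  obtain c where c: "c > 0" "\<And>j x. c * norm x \<le> norm (matrix_pow A j *v x)"
    using expanding_on_subspace_lower_bound[OF assms(2)] by blast
  have inv: "matrix_pow A j ** matrix_pow (matrix_inv A) j = mat 1"
    "matrix_pow (matrix_inv A) j ** matrix_pow A j = mat 1" for j
    using matrix_inv_inverse[OF assms(1)] by (simp_all add: matrix_pow_right_inverse)
  have invertible: "invertible (matrix_powi A j)" for j
    using inv unfolding matrix_powi_def invertible_def by auto
  have "\<exists>C>0. \<forall>x. norm (matrix_pow A j *v x) \<le> C * norm x" for j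
    using matrix_vector_mul_upper_bound[of "matrix_pow A j"] by blast
  then obtain U where U: "\<And>j. U j > 0" "\<And>j x. norm (matrix_pow A j *v x) \<le> U j * norm x"
    by metis
  \<comment> \<open>For negative \<open>j\<close> the constants are the reciprocals of the opposite
    ones for \<open>- j\<close>. No control of \<open>U\<close> in terms of \<open>j\<close> is
    required.\<close>
  define l where "l j = (if j \<ge> 0 then c else inverse (U (nat (- j))))" for j :: int
  define L where "L j = (if j \<ge> 0 then U (nat j) else inverse c)" for j :: int
  have bounds: "l j * norm x \<le> norm (matrix_powi A j *v x) \<and>
      norm (matrix_powi A j *v x) \<le> L j * norm x" for x j
  proof (cases "j \<ge> 0")
    case True
    then show ?thesis
      using c U by (simp add: l_def L_def matrix_powi_def)
  next
    case False
    define m where "m = nat (- j)"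
    \<comment> \<open>Since \<open>x\<close> is the image of \<open>y\<close> under the positive
      power, the two bounds for that power at \<open>y\<close> turn, after division, into the bounds
      for its inverse at \<open>x\<close>.\<close>
    define y where "y = matrix_pow (matrix_inv A) m *v x"
    have "x = matrix_pow A m *v y"
      by (simp add: y_def matrix_vector_mul_assoc inv)
    then have "c * norm y \<le> norm x" "norm x \<le> U m * norm y"
      using c(2)[of y m] U(2)[of m y] by simp_all
    then show ?thesis
      using False c(1) U(1)[of m]
      by (simp add: l_def L_def matrix_powi_def field_simps flip: m_def y_def)
  qed
  \<comment> \<open>Negative \<open>j\<close> are excluded, since there \<open>L j\<close> equals
    \<open>inverse c\<close>. Otherwise \<open>l j = c\<close>, and halving gives the strict
    inequality.\<close>
  have "l j > c / 2" if "M > inverse c" "L j > M" for M j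
    using that c(1) by (auto simp: l_def L_def split: if_splits)
  moreover have "inverse c > 0" "c / 2 > 0" "\<And>j. l j > 0" "\<And>j. L j > 0"
    using c(1) U(1) by (simp_all add: l_def L_def)
  ultimately show ?thesis
    using invertible bounds unfolding expanding_family_def
    by (intro conjI allI exI[of _ l] exI[of _ L] exI[of _ "inverse c"] exI[of _ "c / 2"]) auto
qed

end
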